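(* The following classes of metric groups are bountiful: (1) the class of uniformly non-bounded groups; (2) the class of uniformly non-Roelcke bounded groups; (3) the class of uniformly non-Roelcke precompact groups; (4) the class of uniformly non-$\mathbf{(OB)_k}$-groups (for a fixed natural number $k$); (5) the class of uniformly non-$\mathbf{(OB)}$-groups.
   Context: Metric groups are viewed as metric structures of continuous logic: a group $G$ with a complete bounded metric $d$ for which multiplication and inversion are uniformly continuous (with fixed continuity moduli). A class $\mathcal{K}$ of topological groups is bountiful if for any pair of infinite groups $G\le H$ with $H\in\mathcal{K}$ there is $K\in\mathcal{K}$ such that $G\le K\le H$ and the density character of $G$ (the smallest cardinality of a dense subset) coincides with the density character of $K$. An element $g\in G$ is $\varepsilon$-distant from $A\subseteq G$ if $d(g,a)\geq\varepsilon$ for all $a\in A$. For subsets of $G$, products and powers are pointwise products. - $G$ is uniformly non-bounded if there is an open $V\ni 1$ such that for any natural numbers $m,k$ there is a real $\varepsilon>0$ such that for any $m$-element subset $F\subset G$ there is $g\in G$ which is $\varepsilon$-distant from $FV^k$. - $G$ is uniformly non-Roelcke bounded if there is an open $V\ni 1$ such that for any natural numbers $m,k$ there is a real $\varepsilon>0$ such that for any $m$-element $F\subset G$ there is $g\in G$ which is $\varepsilon$-distant from $V^kFV^k$. - $G$ is uniformly non-Roelcke precompact if there is an open $V\ni 1$ such that for any natural number $m$ there is a real $\varepsilon>0$ such that for any $m$-element $F\subset G$ there is $g\in G$ which is $\varepsilon$-distant from $VFV$. - For a fixed natural number $k$, $G$ is uniformly non-$\mathbf{(OB)_k}$ if there is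 an open symmetric $V\neq\emptyset$ such that for any natural number $m$ there is a real $\varepsilon>0$ such that for any $m$-element $F\subset G$ there is $g\in G$ which is $\varepsilon$-distant from $(FV)^k$. - $G$ is uniformly non-$\mathbf{(OB)}$ if there is an open symmetric $V\neq\emptyset$ such that for any natural numbers $m,k$ there is a real $\varepsilon>0$ such that for any $m$-element $F\subset G$ there is $g\in G$ which is $\varepsilon$-distant from $(FV)^k$. *)

theory Defs
  imports "HOL-Analysis.Analysis" "HOL-Algebra.Coset"
begin

unbundle cardinal_syntax

section \<open>Metric groups\<close>

record 'a metric_struct = "'a monoid" +
  gdist :: "'a \<Rightarrow> 'a \<Rightarrow> real"

abbreviation gtopology :: "('a, 'b) metric_struct_scheme \<Rightarrow> 'a topology" where
  "gtopology G \<equiv> Metric_space.mtopology (carrier G) (gdist G)"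

text \<open>
  The functions \<open>\<mu>\<close> and \<open>\<iota>\<close> are the continuity moduli of multiplication and inversion; they belong
  to the signature, so they are shared by all groups of a class. The convention for
  moduli is that of continuous logic (strict bound on the arguments, non-strict bound on the values),
  with the maximum metric on pairs.
\<close>

locale metric_group = group G + Metric_space "carrier G" "gdist G"
  for \<mu> \<iota> :: "real \<Rightarrow> real" and G :: "('a, 'b) metric_struct_scheme" (structure) +
  assumes complete: "mcomplete"
    and bounded: "mbounded (carrier G)"
    and moduli_pos: "\<epsilon> > 0 \<Longrightarrow> \<mu> \<epsilon> > 0 \<and> \<iota> \<epsilon> > 0"
    and mult_modulus: "\<lbrakk>\<epsilon> > 0; x \<in> carrier G; x' \<in> carrier G; y \<in> carrier G; y' \<in> carrier G;
      gdist G x x' < \<mu> \<epsilon>; gdist G y y' < \<mu> \<epsilon>\<rbrakk> \<Longrightarrow> gdist G (x \<otimes> y) (x' \<otimes> y') \<le> \<epsilon>"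
    and inv_modulus: "\<lbrakk>\<epsilon> > 0; x \<in> carrier G; x' \<in> carrier G; gdist G x x' < \<iota> \<epsilon>\<rbrakk>
      \<Longrightarrow> gdist G (inv x) (inv x') \<le> \<epsilon>"

section \<open>Density character and bountiful classes\<close>

definition dense_in_space :: "'a topology \<Rightarrow> 'a set \<Rightarrow> bool" where
  "dense_in_space X D \<longleftrightarrow> D \<subseteq> topspace X \<and> X closure_of D = topspace X"

definition least_dense :: "'a topology \<Rightarrow> 'a set \<Rightarrow> bool" where
  "least_dense X D \<longleftrightarrow> dense_in_space X D \<and> (\<forall>E. dense_in_space X E \<longrightarrow> |D| \<le>o |E| )"

text \<open>Cardinals are represented by well-orders and have to be compared by \<open>=o\<close>, not by \<open>=\<close>.\<close>

definition density_character :: "'a topology \<Rightarrow> 'a rel" where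
  "density_character X = |SOME D. least_dense X D|"

lemma least_dense_exists: "\<exists>D. least_dense X D"
proof -
  let ?R = "card_of ` {D. dense_in_space X D}"
  have "dense_in_space X (topspace X)"
    by (simp add: dense_in_space_def)
  then have "?R \<noteq> {}" by blast
  moreover have "\<forall>r \<in> ?R. Card_order r" by (auto simp: card_of_Card_order)
  ultimately have "\<exists>r \<in> ?R. \<forall>r' \<in> ?R. r \<le>o r'" by (rule exists_minim_Card_order)
  then show ?thesis by (auto simp: least_dense_def)
qed

lemma density_character_ordIso: "least_dense X D \<Longrightarrow> density_character X =o |D|"
  using someI_ex[OF least_dense_exists[of X]]
  by (auto simp: density_character_def least_dense_def ordIso_iff_ordLeq)

text \<open>
  Up to renaming, an infinite group below \<open>H\<close> is given by its carrier, an infinite subgroup \<open>A\<close> of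
  \<open>H\<close>, with the induced structure \<open>H\<lparr>carrier := A\<rparr>\<close> (in particular, with the restricted metric).
  \<open>A\<close> need not be closed in \<open>H\<close>; the intermediate group \<open>B\<close> is required to belong to the class, so it
  has every property that the class demands, completeness included.
\<close>

definition bountiful :: "'a metric_struct set \<Rightarrow> bool" where
  "bountiful \<K> \<longleftrightarrow>
    (\<forall>H \<in> \<K>. \<forall>A. subgroup A H \<and> infinite A \<longrightarrow>
      (\<exists>B. A \<subseteq> B \<and> subgroup B H \<and> H\<lparr>carrier := B\<rparr> \<in> \<K> \<and>
        density_character (gtopology (H\<lparr>carrier := A\<rparr>))
          =o density_character (gtopology (H\<lparr>carrier := B\<rparr>))))"

section \<open>Uniform non-boundedness conditions\<close>

primrec set_power :: "('a, 'b) monoid_scheme \<Rightarrow> 'a set \<Rightarrow> nat \<Rightarrow> 'a set" where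
  "set_power G A 0 = {\<one>\<^bsub>G\<^esub>}"
| "set_power G A (Suc n) = set_power G A n <#>\<^bsub>G\<^esub> A"

definition distant :: "('a, 'b) metric_struct_scheme \<Rightarrow> real \<Rightarrow> 'a \<Rightarrow> 'a set \<Rightarrow> bool" where
  "distant G \<epsilon> g A \<longleftrightarrow> (\<forall>a \<in> A. gdist G g a \<ge> \<epsilon>)"

definition subsets_of_size :: "('a, 'b) metric_struct_scheme \<Rightarrow> nat \<Rightarrow> 'a set set" where
  "subsets_of_size G m = {F. F \<subseteq> carrier G \<and> finite F \<and> card F = m}"

definition open_nbhd_one :: "('a, 'b) metric_struct_scheme \<Rightarrow> 'a set \<Rightarrow> bool" where
  "open_nbhd_one G V \<longleftrightarrow> openin (gtopology G) V \<and> \<one>\<^bsub>G\<^esub> \<in> V"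

definition open_symmetric :: "('a, 'b) metric_struct_scheme \<Rightarrow> 'a set \<Rightarrow> bool" where
  "open_symmetric G V \<longleftrightarrow> openin (gtopology G) V \<and> set_inv\<^bsub>G\<^esub> V = V \<and> V \<noteq> {}"

definition uniformly_non_bounded :: "('a, 'b) metric_struct_scheme \<Rightarrow> bool" where
  "uniformly_non_bounded G \<longleftrightarrow>
    (\<exists>V. open_nbhd_one G V \<and>
      (\<forall>m k. \<exists>\<epsilon>>0. \<forall>F \<in> subsets_of_size G m. \<exists>g \<in> carrier G.
        distant G \<epsilon> g (F <#>\<^bsub>G\<^esub> set_power G V k)))"

definition uniformly_non_Roelcke_bounded :: "('a, 'b) metric_struct_scheme \<Rightarrow> bool" where
  "uniformly_non_Roelcke_bounded G \<longleftrightarrow>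
    (\<exists>V. open_nbhd_one G V \<and>
      (\<forall>m k. \<exists>\<epsilon>>0. \<forall>F \<in> subsets_of_size G m. \<exists>g \<in> carrier G.
        distant G \<epsilon> g (set_power G V k <#>\<^bsub>G\<^esub> F <#>\<^bsub>G\<^esub> set_power G V k)))"

definition uniformly_non_Roelcke_precompact :: "('a, 'b) metric_struct_scheme \<Rightarrow> bool" where
  "uniformly_non_Roelcke_precompact G \<longleftrightarrow>
    (\<exists>V. open_nbhd_one G V \<and>
      (\<forall>m. \<exists>\<epsilon>>0. \<forall>F \<in> subsets_of_size G m. \<exists>g \<in> carrier G.
        distant G \<epsilon> g (V <#>\<^bsub>G\<^esub> F <#>\<^bsub>G\<^esub> V)))"

definition uniformly_non_OB_k :: "nat \<Rightarrow> ('a, 'b) metric_struct_scheme \<Rightarrow> bool" where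
  "uniformly_non_OB_k k G \<longleftrightarrow>
    (\<exists>V. open_symmetric G V \<and>
      (\<forall>m. \<exists>\<epsilon>>0. \<forall>F \<in> subsets_of_size G m. \<exists>g \<in> carrier G.
        distant G \<epsilon> g (set_power G (F <#>\<^bsub>G\<^esub> V) k)))"

definition uniformly_non_OB :: "('a, 'b) metric_struct_scheme \<Rightarrow> bool" where
  "uniformly_non_OB G \<longleftrightarrow>
    (\<exists>V. open_symmetric G V \<and>
      (\<forall>m k. \<exists>\<epsilon>>0. \<forall>F \<in> subsets_of_size G m. \<exists>g \<in> carrier G.
        distant G \<epsilon> g (set_power G (F <#>\<^bsub>G\<^esub> V) k)))"

end

theory Submission
  imports Defs "HOL-Library.Countable_Set_Type"
begin

text \<open>
  Let \<open>H\<close> be in one of the classes, with witness \<open>V\<close>, and let \<open>A\<close> be an infinite subgroup of \<open>H\<close>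
  with a dense subset \<open>D\<close> of least cardinality. The proof is a downward Loewenheim--Skolem argument
  followed by a passage to the closure.

  \<^item> All five conditions have the form: for every \<open>m\<close> and \<open>k\<close> there is \<open>\<epsilon> > 0\<close> such that every
  \<open>m\<close>-element set \<open>F\<close> leaves some \<open>g\<close> that is \<open>\<epsilon>\<close>-distant from a fixed product of copies of \<open>F\<close> and
  \<open>V\<close>. Such products are called patterns below, and one argument serves for all of them.

  \<^item> A choice of these \<open>g\<close> gives countably many finitary operations on \<open>H\<close>. Closing \<open>D\<close> under them,
  under the group operations and under a constant naming a point of \<open>V\<close> yields a subgroup \<open>S\<close> with
  \<open>|S| \<le>o |D|\<close> (\<open>closure_under_countably_many_operations\<close>). Its closure \<open>B\<close> is complete, contains \<open>A\<close>
  and meets \<open>V\<close>.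

  \<^item> The witness for \<open>B\<close> is \<open>V \<inter> B\<close>. Shrinking \<open>V\<close> only shrinks the products, so the points chosen
  in \<open>S\<close> remain distant, but they were chosen only for \<open>F \<subseteq> S\<close>. A general \<open>F \<subseteq> B\<close> is approximated by
  some \<open>F' \<subseteq> S\<close>. The moduli of multiplication make every product vary uniformly with \<open>F\<close>, no matter
  how large \<open>V\<close> is (\<open>pattern_set_uniform\<close>), so a point that is \<open>\<epsilon>\<close>-distant from the product for
  \<open>F'\<close> is \<open>\<epsilon>/2\<close>-distant from the product for \<open>F\<close>.

  \<^item> The density character of \<open>B\<close> is at most \<open>|S| \<le>o |D|\<close>, and it is at least that of \<open>A\<close> because
  the density character of metric spaces is monotone (\<open>dense_subset_of_subspace\<close>).
\<close>

section \<open>Closing an infinite set under countably many finitary operations\<close>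

lemma card_lists_of_length:
  assumes "infinite S"
  shows "|{xs. set xs \<subseteq> S \<and> length xs = n}| \<le>o |S|"
proof (induction n)
  case 0
  have "{xs. set xs \<subseteq> S \<and> length xs = 0} = {[]}" by auto
  then show ?case using assms
    by (metis card_of_singl_ordLeq infinite_imp_nonempty)
next
  case (Suc n)
  let ?L = "{xs. set xs \<subseteq> S \<and> length xs = n}"
  have "{xs. set xs \<subseteq> S \<and> length xs = Suc n} \<subseteq> (\<lambda>(x, xs). x # xs) ` (S \<times> ?L)"
  proof
    fix xs assume "xs \<in> {xs. set xs \<subseteq> S \<and> length xs = Suc n}"
    then show "xs \<in> (\<lambda>(x, xs). x # xs) ` (S \<times> ?L)" by (cases xs) auto
  qed
  then have "|{xs. set xs \<subseteq> S \<and> length xs = Suc n}| \<le>o |S \<times> ?L|"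
    by (meson card_of_image card_of_mono1 ordLeq_transitive)
  also have "|S \<times> ?L| \<le>o |S|"
    using assms Suc by (intro card_of_Sigma_ordLeq_infinite) (auto intro: ordIso_imp_ordLeq[OF card_of_refl])
  finally show ?case .
qed

lemma card_lists_infinite:
  assumes "infinite S"
  shows "|lists S| \<le>o |S|"
proof -
  have "lists S = (\<Union>n. {xs. set xs \<subseteq> S \<and> length xs = n})" by auto
  then show ?thesis
    using card_lists_of_length[OF assms] assms infinite_iff_card_of_nat
    by (simp only:) (intro card_of_UNION_ordLeq_infinite, blast+)
qed

lemma card_one_step_closure:
  fixes Op :: "('a list \<Rightarrow> 'a) set"
  assumes "countable Op" "infinite S"
  shows "|S \<union> (\<Union>f\<in>Op. f ` lists S)| \<le>o |S|"
proof -
  have "|\<Union>f\<in>Op. f ` lists S| \<le>o |S|"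
  proof (rule card_of_UNION_ordLeq_infinite)
    show "infinite S" by fact
    show "|Op| \<le>o |S|"
      using assms by (meson countable_card_of_nat infinite_iff_card_of_nat ordLeq_transitive)
    show "\<forall>f\<in>Op. |f ` lists S| \<le>o |S|"
      using card_lists_infinite[OF assms(2)] card_of_image ordLeq_transitive by blast
  qed
  then show ?thesis
    using assms(2)
    by (intro card_of_Un_ordLeq_infinite_Field card_of_Card_order ordIso_imp_ordLeq[OF card_of_refl])
      (simp_all only: Field_card_of not_False_eq_True)
qed

text \<open>
  Operations take lists, so that every finite arity is covered at once; the one-step closures form an
  increasing chain of sets of the size of \<open>D\<close>, and a list over their union lives at a finite stage.
\<close>

lemma closure_under_countably_many_operations:
  fixes Op :: "('a list \<Rightarrow> 'a) set"
  assumes "countable Op" "infinite D" "D \<subseteq> C"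
    and closed: "\<And>f xs. \<lbrakk>f \<in> Op; set xs \<subseteq> C\<rbrakk> \<Longrightarrow> f xs \<in> C"
  obtains S where "D \<subseteq> S" "S \<subseteq> C" "|S| \<le>o |D|"
    "\<And>f xs. \<lbrakk>f \<in> Op; set xs \<subseteq> S\<rbrakk> \<Longrightarrow> f xs \<in> S"
proof -
  define step where "step S = S \<union> (\<Union>f\<in>Op. f ` lists S)" for S
  define stage where "stage n = (step ^^ n) D" for n
  have stage_0: "stage 0 = D" and stage_Suc: "stage (Suc n) = step (stage n)" for n
    by (simp_all add: stage_def)
  have mono: "stage i \<subseteq> stage j" if "i \<le> j" for i j
    using that by (rule lift_Suc_mono_le[of stage, rotated]) (simp add: stage_Suc step_def)
  have "stage n \<subseteq> C" for n
    by (induction n) (use assms(3) closed in \<open>auto simp: stage_0 stage_Suc step_def lists_eq_set\<close>)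
  moreover have card: "|stage n| \<le>o |D|" for n
  proof (induction n)
    case 0
    show ?case unfolding stage_0 by (rule ordIso_imp_ordLeq[OF card_of_refl])
  next
    case (Suc n)
    have "infinite (stage n)" using mono[of 0 n] assms(2) by (auto simp: stage_0 finite_subset)
    then have "|stage (Suc n)| \<le>o |stage n|"
      using card_one_step_closure[OF assms(1)] by (simp add: stage_Suc step_def)
    then show ?case using Suc ordLeq_transitive by blast
  qed
  moreover have "|\<Union>n. stage n| \<le>o |D|"
    using card assms(2) infinite_iff_card_of_nat by (intro card_of_UNION_ordLeq_infinite) blast+
  moreover have "f xs \<in> (\<Union>n. stage n)" if "f \<in> Op" "set xs \<subseteq> (\<Union>n. stage n)" for f xs
  proof -
    have "\<exists>n. set xs \<subseteq> stage n"
      using that(2)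
    proof (induction xs)
      case (Cons x xs)
      then obtain i j where "x \<in> stage i" "set xs \<subseteq> stage j" by auto
      then have "set (x # xs) \<subseteq> stage (max i j)" using mono[of i "max i j"] mono[of j "max i j"] by auto
      then show ?case by blast
    qed simp
    then obtain n where "set xs \<subseteq> stage n" by blast
    then have "f xs \<in> stage (Suc n)" using that(1) by (auto simp: stage_Suc step_def)
    then show ?thesis by blast
  qed
  ultimately show thesis
    using that[of "\<Union>n. stage n"] stage_0 by blast
qed

section \<open>Density in metric spaces\<close>

lemma (in Metric_space) dense_in_space_iff:
  "dense_in_space mtopology D \<longleftrightarrow> D \<subseteq> M \<and> (\<forall>x\<in>M. \<forall>r>0. \<exists>y\<in>D. d x y < r)"
proof
  assume "dense_in_space mtopology D"
  then show "D \<subseteq> M \<and> (\<forall>x\<in>M. \<forall>r>0. \<exists>y\<in>D. d x y < r)"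
    by (auto simp: dense_in_space_def metric_closure_of set_eq_iff in_mball) blast
next
  assume D: "D \<subseteq> M \<and> (\<forall>x\<in>M. \<forall>r>0. \<exists>y\<in>D. d x y < r)"
  then show "dense_in_space mtopology D"
    unfolding dense_in_space_def metric_closure_of by (auto simp: in_mball) (meson subsetD)
qed

lemma (in Metric_space) infinite_dense:
  assumes "infinite M" "dense_in_space mtopology D"
  shows "infinite D"
proof
  assume "finite D"
  then have "closedin mtopology D"
    using assms(2) Hausdorff_imp_t1_space[OF Hausdorff_space_mtopology]
    by (simp add: t1_space_closedin_finite dense_in_space_def)
  then have "D = M"
    using assms(2) by (simp add: dense_in_space_def closure_of_closedin)
  then show False using assms(1) \<open>finite D\<close> by simp
qed

text \<open>
  Picking one point of \<open>A\<close> in every ball of radius \<open>1/(n+1)\<close> around a point of \<open>E\<close> that meets \<open>A\<close>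
  gives a dense subset of \<open>A\<close>, and there are only \<open>|E|\<close> many such balls.
\<close>

lemma (in Metric_space) dense_subset_of_subspace:
  assumes "dense_in_space mtopology E" "infinite E" "A \<subseteq> M"
  obtains D where "dense_in_space (Metric_space.mtopology A d) D" "|D| \<le>o |E|"
proof -
  interpret A: Metric_space A d using assms(3) by (rule subspace)
  define near where "near e n a \<longleftrightarrow> a \<in> A \<and> d e a < 1 / Suc n" for e n a
  define pick where "pick = (\<lambda>(e, n). SOME a. near e n a)"
  define I where "I = {(e, n). e \<in> E \<and> (\<exists>a. near e n a)}"
  have pick: "near e n (pick (e, n))" if "(e, n) \<in> I" for e n
    using that unfolding I_def pick_def by (auto intro: someI_ex)
  have "dense_in_space A.mtopology (pick ` I)"
    unfolding A.dense_in_space_iff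
  proof (intro conjI ballI allI impI)
    show "pick ` I \<subseteq> A" using pick by (auto simp: near_def)
  next
    fix x :: 'a and r :: real assume x: "x \<in> A" and r: "r > 0"
    obtain n where n: "1 / Suc n < r / 2" using r nat_approx_posE[of "r/2"] by auto
    obtain e where e: "e \<in> E" "d x e < 1 / Suc n"
      using assms x unfolding dense_in_space_iff
      by (metis divide_pos_pos of_nat_0_less_iff subsetD zero_less_Suc zero_less_one)
    then have I: "(e, n) \<in> I" using x by (auto simp: I_def near_def commute)
    let ?p = "pick (e, n)"
    have p: "?p \<in> A" "d e ?p < 1 / Suc n" using pick[OF I] by (auto simp: near_def)
    have "e \<in> M" using assms(1) e by (auto simp: dense_in_space_def)
    then have "d x ?p \<le> d x e + d e ?p" using x p assms(3) by (intro triangle) auto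
    also have "\<dots> < r" using e p n by linarith
    finally show "\<exists>y\<in>pick ` I. d x y < r" using I by blast
  qed
  moreover have "|pick ` I| \<le>o |E|"
  proof -
    have "|pick ` I| \<le>o |I|" by (rule card_of_image)
    also have "|I| \<le>o |E \<times> (UNIV :: nat set)|" by (rule card_of_mono1) (auto simp: I_def)
    also have "|E \<times> (UNIV :: nat set)| \<le>o |E|"
      using assms(2) ordIso_imp_ordLeq[OF card_of_refl] infinite_iff_card_of_nat
      by (intro card_of_Sigma_ordLeq_infinite) blast+
    finally show ?thesis .
  qed
  ultimately show thesis using that by blast
qed

section \<open>Products of a finite set and a neighbourhood\<close>

text \<open>
  A pattern records the order in which copies of the finite set (\<open>Sample\<close>) and of the neighbourhood
  (\<open>Nbhd\<close>) are multiplied, so that properties common to all five kinds of products are proved by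
  induction.
\<close>

datatype pattern = Unit | Sample | Nbhd | Prod pattern pattern

primrec pattern_power :: "pattern \<Rightarrow> nat \<Rightarrow> pattern" where
  "pattern_power p 0 = Unit"
| "pattern_power p (Suc n) = Prod (pattern_power p n) p"

primrec pattern_set :: "('a, 'b) monoid_scheme \<Rightarrow> 'a set \<Rightarrow> 'a set \<Rightarrow> pattern \<Rightarrow> 'a set" where
  "pattern_set G V F Unit = {\<one>\<^bsub>G\<^esub>}"
| "pattern_set G V F Sample = F"
| "pattern_set G V F Nbhd = V"
| "pattern_set G V F (Prod p q) = pattern_set G V F p <#>\<^bsub>G\<^esub> pattern_set G V F q"

lemma pattern_set_power:
  "pattern_set G V F (pattern_power p n) = set_power G (pattern_set G V F p) n"
  by (induction n) simp_all

lemma pattern_set_mono: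
  "\<lbrakk>V \<subseteq> V'; F \<subseteq> F'\<rbrakk> \<Longrightarrow> pattern_set G V F p \<subseteq> pattern_set G V' F' p"
  by (induction p) (simp_all add: mono_set_mult)

lemma pattern_set_carrier_update:
  "pattern_set (G\<lparr>carrier := B\<rparr>) V F p = pattern_set G V F p"
  by (induction p) (simp_all add: set_mult_def)

definition (in Metric_space) near_subset :: "real \<Rightarrow> 'a set \<Rightarrow> 'a set \<Rightarrow> bool" where
  "near_subset r X Y \<longleftrightarrow> X \<subseteq> M \<and> Y \<subseteq> M \<and> (\<forall>x\<in>X. \<exists>y\<in>Y. d x y < r)"

lemma (in Metric_space) near_subset_refl: "\<lbrakk>X \<subseteq> M; r > 0\<rbrakk> \<Longrightarrow> near_subset r X X"
  unfolding near_subset_def by (metis mdist_zero subsetD)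

lemma (in Metric_space) near_subset_weaken: "\<lbrakk>near_subset r X Y; r \<le> s\<rbrakk> \<Longrightarrow> near_subset s X Y"
  unfolding near_subset_def by (meson less_le_trans)

text \<open>The modulus gives only a non-strict bound on the products, hence the factor one half.\<close>

lemma (in metric_group) near_subset_set_mult:
  assumes "\<epsilon> > 0" and X: "near_subset (\<mu> (\<epsilon> / 2)) X X'" and Y: "near_subset (\<mu> (\<epsilon> / 2)) Y Y'"
  shows "near_subset \<epsilon> (X <#> Y) (X' <#> Y')"
  unfolding near_subset_def
proof (intro conjI ballI)
  show "X <#> Y \<subseteq> carrier G" "X' <#> Y' \<subseteq> carrier G"
    using X Y unfolding near_subset_def by (simp_all add: set_mult_closed)
next
  fix z assume "z \<in> X <#> Y"
  then obtain x y where z: "z = x \<otimes> y" and xy: "x \<in> X" "y \<in> Y"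
    by (auto simp: set_mult_def)
  obtain x' where x': "x' \<in> X'" "gdist G x x' < \<mu> (\<epsilon> / 2)"
    using X xy by (auto simp: near_subset_def)
  obtain y' where y': "y' \<in> Y'" "gdist G y y' < \<mu> (\<epsilon> / 2)"
    using Y xy by (auto simp: near_subset_def)
  have "x \<in> carrier G" "x' \<in> carrier G" "y \<in> carrier G" "y' \<in> carrier G"
    using X Y xy x' y' by (auto simp: near_subset_def)
  then have "gdist G z (x' \<otimes> y') \<le> \<epsilon> / 2"
    unfolding z using mult_modulus[of "\<epsilon> / 2"] assms(1) x'(2) y'(2) by simp
  moreover have "x' \<otimes> y' \<in> X' <#> Y'"
    using x' y' by (auto simp: set_mult_def)
  ultimately show "\<exists>z'\<in>X' <#> Y'. gdist G z z' < \<epsilon>"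
    using assms(1) by (intro bexI[of _ "x' \<otimes> y'"]) auto
qed

text \<open>
  The factors from \<open>V\<close> are kept and only those from \<open>F\<close> are replaced, so the bound \<open>\<delta>\<close> depends
  neither on the size of \<open>V\<close> nor on that of \<open>F\<close>.
\<close>

lemma (in metric_group) pattern_set_uniform:
  assumes V: "V \<subseteq> carrier G" and "\<epsilon> > 0"
  shows "\<exists>\<delta>>0. \<forall>F F'. near_subset \<delta> F F' \<longrightarrow>
    near_subset \<epsilon> (pattern_set G V F p) (pattern_set G V F' p)"
  using \<open>\<epsilon> > 0\<close>
proof (induction p arbitrary: \<epsilon>)
  case Unit
  have "near_subset \<epsilon> {\<one>} {\<one>}" using Unit by (intro near_subset_refl) auto
  then show ?case by (intro exI[of _ 1]) simp
next
  case Sample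
  then show ?case by (intro exI[of _ \<epsilon>]) simp
next
  case Nbhd
  have "near_subset \<epsilon> V V" using Nbhd V by (intro near_subset_refl)
  then show ?case by (intro exI[of _ 1]) simp
next
  case (Prod p q)
  define \<eta> where "\<eta> = \<mu> (\<epsilon> / 2)"
  have \<eta>: "\<eta> > 0" unfolding \<eta>_def using moduli_pos[of "\<epsilon> / 2"] Prod.prems by simp
  obtain \<delta>1 where \<delta>1: "\<delta>1 > 0" "\<forall>F F'. near_subset \<delta>1 F F' \<longrightarrow>
      near_subset \<eta> (pattern_set G V F p) (pattern_set G V F' p)"
    using Prod.IH(1)[OF \<eta>] by blast
  obtain \<delta>2 where \<delta>2: "\<delta>2 > 0" "\<forall>F F'. near_subset \<delta>2 F F' \<longrightarrow>
      near_subset \<eta> (pattern_set G V F q) (pattern_set G V F' q)"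
    using Prod.IH(2)[OF \<eta>] by blast
  show ?case
  proof (intro exI[of _ "min \<delta>1 \<delta>2"] conjI allI impI)
    show "0 < min \<delta>1 \<delta>2" using \<delta>1 \<delta>2 by simp
    fix F F' assume F: "near_subset (min \<delta>1 \<delta>2) F F'"
    have "near_subset \<eta> (pattern_set G V F p) (pattern_set G V F' p)"
      using \<delta>1(2) near_subset_weaken[OF F, of \<delta>1] by simp
    moreover have "near_subset \<eta> (pattern_set G V F q) (pattern_set G V F' q)"
      using \<delta>2(2) near_subset_weaken[OF F, of \<delta>2] by simp
    ultimately show "near_subset \<epsilon> (pattern_set G V F (Prod p q)) (pattern_set G V F' (Prod p q))"
      using near_subset_set_mult[OF Prod.prems] by (simp add: \<eta>_def)
  qed
qed

section \<open>Closed subgroups of metric groups\<close>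

lemma (in metric_group) subgroup_closure:
  assumes S: "subgroup S G"
  shows "subgroup (mtopology closure_of S) G"
proof -
  let ?B = "mtopology closure_of S"
  have sub: "S \<subseteq> carrier G" using S by (rule subgroup.subset)
  have mem: "x \<in> ?B \<longleftrightarrow> x \<in> carrier G \<and> (\<forall>r>0. \<exists>y\<in>S. gdist G x y < r)" for x
    using sub by (auto simp: metric_closure_of) (meson subsetD)
  show ?thesis
  proof (rule subgroupI)
    show "?B \<subseteq> carrier G" by (auto simp: mem)
    show "?B \<noteq> {}"
      using closure_of_subset[of S mtopology] sub subgroup.one_closed[OF S] by auto
  next
    fix x assume x: "x \<in> ?B"
    show "inv x \<in> ?B" unfolding mem
    proof (intro conjI allI impI)
      show "inv x \<in> carrier G" using x by (simp add: mem)
      fix r :: real assume r: "r > 0"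
      obtain y where y: "y \<in> S" "gdist G x y < \<iota> (r/2)"
        using x moduli_pos[of "r/2"] r by (auto simp: mem)
      have "gdist G (inv x) (inv y) \<le> r/2"
        using inv_modulus[of "r/2" x y] x y r sub by (auto simp: mem)
      then show "\<exists>y\<in>S. gdist G (inv x) y < r"
        using y r subgroup.m_inv_closed[OF S] by (intro bexI[of _ "inv y"]) auto
    qed
  next
    fix x y assume x: "x \<in> ?B" and y: "y \<in> ?B"
    show "x \<otimes> y \<in> ?B" unfolding mem
    proof (intro conjI allI impI)
      show "x \<otimes> y \<in> carrier G" using x y by (simp add: mem)
      fix r :: real assume r: "r > 0"
      obtain x' where x': "x' \<in> S" "gdist G x x' < \<mu> (r/2)"
        using x moduli_pos[of "r/2"] r by (auto simp: mem)
      obtain y' where y': "y' \<in> S" "gdist G y y' < \<mu> (r/2)"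
        using y moduli_pos[of "r/2"] r by (auto simp: mem)
      have "gdist G (x \<otimes> y) (x' \<otimes> y') \<le> r/2"
        using mult_modulus[of "r/2" x x' y y'] x y x' y' r sub by (auto simp: mem)
      then show "\<exists>z\<in>S. gdist G (x \<otimes> y) z < r"
        using x' y' r subgroup.m_closed[OF S] by (intro bexI[of _ "x' \<otimes> y'"]) auto
    qed
  qed
qed

lemma (in metric_group) closed_subgroup_metric_group:
  assumes B: "subgroup B G" and "closedin mtopology B"
  shows "metric_group \<mu> \<iota> (G\<lparr>carrier := B\<rparr>)"
proof -
  have sub: "B \<subseteq> carrier G" using B by (rule subgroup.subset)
  interpret B: Submetric "carrier G" "gdist G" B by unfold_locales (rule sub)
  have inv: "inv\<^bsub>G\<lparr>carrier := B\<rparr>\<^esub> x = inv x" if "x \<in> B" for x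
    using m_inv_consistent[OF B that] by simp
  show ?thesis
  proof (rule metric_group.intro)
    show "group (G\<lparr>carrier := B\<rparr>)" using B by (rule subgroup_imp_group)
    show "Metric_space (carrier (G\<lparr>carrier := B\<rparr>)) (gdist (G\<lparr>carrier := B\<rparr>))"
      using B.sub.Metric_space_axioms by simp
    show "metric_group_axioms \<mu> \<iota> (G\<lparr>carrier := B\<rparr>)"
    proof (unfold_locales, goal_cases)
      case 1
      then show ?case using B.closedin_mcomplete_imp_mcomplete[OF assms(2) complete] by simp
    next
      case 2
      then show ?case using mbounded_subset[OF bounded sub] by (simp add: B.mbounded_submetric)
    next
      case 3
      then show ?case using moduli_pos by simp
    next
      case 4
      then show ?case using mult_modulus sub by (simp add: subset_iff)
    next
      case 5
      then show ?case using inv_modulus sub by (simp add: inv subset_iff)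
    qed
  qed
qed

lemma (in metric_group) openin_subgroup:
  assumes "subgroup B G" "openin mtopology V"
  shows "openin (gtopology (G\<lparr>carrier := B\<rparr>)) (V \<inter> B)"
proof -
  interpret B: Submetric "carrier G" "gdist G" B
    using subgroup.subset[OF assms(1)] by unfold_locales
  show ?thesis
    using assms(2) by (auto simp: B.mtopology_submetric openin_subtopology)
qed

lemma (in metric_group) open_nbhd_one_subgroup:
  assumes "subgroup B G" "open_nbhd_one G V"
  shows "open_nbhd_one (G\<lparr>carrier := B\<rparr>) (V \<inter> B)"
  using assms openin_subgroup subgroup.one_closed[OF assms(1)] by (simp add: open_nbhd_one_def)

lemma (in metric_group) open_symmetric_subgroup:
  assumes B: "subgroup B G" and V: "open_symmetric G V" and "V \<inter> B \<noteq> {}"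
  shows "open_symmetric (G\<lparr>carrier := B\<rparr>) (V \<inter> B)"
proof -
  have sub: "V \<subseteq> carrier G" using V by (auto simp: open_symmetric_def openin_mtopology)
  have *: "inv\<^bsub>G\<lparr>carrier := B\<rparr>\<^esub> x = inv x" if "x \<in> B" for x
    using m_inv_consistent[OF B that] by simp
  have inv: "inv x \<in> V \<inter> B" if "x \<in> V \<inter> B" for x
    using that V subgroup.m_inv_closed[OF B] by (auto simp: open_symmetric_def SET_INV_def)
  have "set_inv\<^bsub>G\<lparr>carrier := B\<rparr>\<^esub> (V \<inter> B) = V \<inter> B"
  proof
    show "set_inv\<^bsub>G\<lparr>carrier := B\<rparr>\<^esub> (V \<inter> B) \<subseteq> V \<inter> B"
      using inv by (auto simp: SET_INV_def *)
    show "V \<inter> B \<subseteq> set_inv\<^bsub>G\<lparr>carrier := B\<rparr>\<^esub> (V \<inter> B)"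
    proof
      fix x assume x: "x \<in> V \<inter> B"
      then have "x = inv\<^bsub>G\<lparr>carrier := B\<rparr>\<^esub> (inv x)" using inv[OF x] sub by (auto simp: *)
      then show "x \<in> set_inv\<^bsub>G\<lparr>carrier := B\<rparr>\<^esub> (V \<inter> B)"
        using inv[OF x] unfolding SET_INV_def by blast
    qed
  qed
  then show ?thesis
    using V openin_subgroup[OF B] assms(3) by (simp add: open_symmetric_def)
qed

section \<open>Descent of uniform escape\<close>

text \<open>
  The family \<open>p\<close> carries the exponent \<open>k\<close>; conditions in which \<open>k\<close> is absent or fixed are the
  constant families.
\<close>

definition escapes :: "('a, 'b) metric_struct_scheme \<Rightarrow> 'a set \<Rightarrow> (nat \<Rightarrow> pattern) \<Rightarrow> bool" where
  "escapes G V p \<longleftrightarrow> (\<forall>m k. \<exists>\<epsilon>>0. \<forall>F \<in> subsets_of_size G m. \<exists>g \<in> carrier G.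
    distant G \<epsilon> g (pattern_set G V F (p k)))"

text \<open>
  This is the Skolem hull of \<open>D\<close>. Escaping points are chosen once for each finite set, and each choice
  function becomes a family of finitary operations by letting it act on the set of entries of a list.
  The constant \<open>v\<close> is meant to be a point of \<open>V\<close>.
\<close>

lemma (in metric_group) escaping_subgroup:
  assumes "escapes G V p" "v \<in> carrier G" "infinite D" "D \<subseteq> carrier G"
  obtains S where "subgroup S G" "D \<subseteq> S" "v \<in> S" "|S| \<le>o |D|"
    "\<forall>m k. \<exists>\<epsilon>>0. \<forall>F \<in> subsets_of_size (G\<lparr>carrier := S\<rparr>) m. \<exists>g \<in> S.
      distant G \<epsilon> g (pattern_set G V F (p k))"
proof -
  obtain \<epsilon> where \<epsilon>: "\<And>m k. \<epsilon> m k > 0" "\<And>m k F. F \<in> subsets_of_size G m \<Longrightarrow>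
      \<exists>g \<in> carrier G. distant G (\<epsilon> m k) g (pattern_set G V F (p k))"
    using assms(1) unfolding escapes_def by metis
  have "\<forall>m k F. \<exists>g. g \<in> carrier G \<and> (F \<in> subsets_of_size G m \<longrightarrow>
      distant G (\<epsilon> m k) g (pattern_set G V F (p k)))"
    using \<epsilon>(2) one_closed by blast
  then obtain g where g: "\<And>m k F. g m k F \<in> carrier G" "\<And>m k F. F \<in> subsets_of_size G m \<Longrightarrow>
      distant G (\<epsilon> m k) (g m k F) (pattern_set G V F (p k))"
    by metis
  define prod_list where "prod_list xs = foldr (\<otimes>) xs \<one>" for xs
  have prod_closed: "prod_list xs \<in> carrier G" if "set xs \<subseteq> carrier G" for xs
    using that by (induction xs) (auto simp: prod_list_def)
  define Op where "Op = {\<lambda>_. v, prod_list, \<lambda>xs. inv (prod_list xs)}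
    \<union> (\<lambda>(m, k) xs. g m k (set xs)) ` UNIV"
  have "countable Op" by (simp add: Op_def)
  moreover have "f xs \<in> carrier G" if "f \<in> Op" "set xs \<subseteq> carrier G" for f xs
    using that assms(2) prod_closed g(1) by (auto simp: Op_def)
  ultimately obtain S where S: "D \<subseteq> S" "S \<subseteq> carrier G" "|S| \<le>o |D|"
      and cl: "\<And>f xs. \<lbrakk>f \<in> Op; set xs \<subseteq> S\<rbrakk> \<Longrightarrow> f xs \<in> S"
    using closure_under_countably_many_operations[OF _ assms(3,4)] by metis
  have v: "v \<in> S" using cl[of "\<lambda>_. v" "[]"] by (simp add: Op_def)
  have "subgroup S G"
  proof (rule subgroupI)
    show "S \<noteq> {}" using v by blast
    show "inv x \<in> S" if "x \<in> S" for x
      using cl[of "\<lambda>xs. inv (prod_list xs)" "[x]"] that S(2) by (auto simp: Op_def prod_list_def)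
    show "x \<otimes> y \<in> S" if "x \<in> S" "y \<in> S" for x y
    proof -
      have "prod_list [x, y] = x \<otimes> y" using that S(2) by (auto simp: prod_list_def)
      then show ?thesis using cl[of prod_list "[x, y]"] that by (auto simp: Op_def)
    qed
  qed (rule S(2))
  moreover have "\<exists>h \<in> S. distant G (\<epsilon> m k) h (pattern_set G V F (p k))"
    if "F \<in> subsets_of_size (G\<lparr>carrier := S\<rparr>) m" for m k F
  proof -
    have F: "F \<subseteq> S" "finite F" "F \<in> subsets_of_size G m"
      using that S(2) by (auto simp: subsets_of_size_def)
    obtain xs where xs: "set xs = F" using finite_list[OF F(2)] by blast
    have "(\<lambda>xs. g m k (set xs)) \<in> Op" by (auto simp: Op_def)
    then have "g m k F \<in> S" using cl[of "\<lambda>xs. g m k (set xs)" xs] xs F(1) by simp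
    then show ?thesis using g(2)[OF F(3)] by blast
  qed
  ultimately show thesis using that S v \<epsilon>(1) by blast
qed

text \<open>
  An \<open>m\<close>-element subset of the closure is approximated by a subset of \<open>S\<close> that may be smaller; it is
  padded to \<open>m\<close> elements, which only enlarges the product that has to be avoided.
\<close>

lemma (in metric_group) escapes_closure:
  assumes S: "S \<subseteq> carrier G" "infinite S" and V: "V \<subseteq> carrier G"
    and esc: "\<forall>m k. \<exists>\<epsilon>>0. \<forall>F \<in> subsets_of_size (G\<lparr>carrier := S\<rparr>) m. \<exists>g \<in> S.
      distant G \<epsilon> g (pattern_set G V F (p k))"
  defines "B \<equiv> mtopology closure_of S"
  shows "escapes (G\<lparr>carrier := B\<rparr>) (V \<inter> B) p"
  unfolding escapes_def
proof (intro allI)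
  fix m k
  have B: "B \<subseteq> carrier G" by (simp add: B_def closure_of_subset_topspace[of mtopology, simplified])
  have SB: "S \<subseteq> B" using S(1) by (simp add: B_def closure_of_subset)
  have approx: "\<exists>y\<in>S. gdist G x y < r" if "x \<in> B" "r > 0" for x r
    using that by (auto simp: B_def metric_closure_of)
  obtain \<epsilon> where \<epsilon>: "\<epsilon> > 0" "\<And>F. F \<in> subsets_of_size (G\<lparr>carrier := S\<rparr>) m \<Longrightarrow>
      \<exists>g \<in> S. distant G \<epsilon> g (pattern_set G V F (p k))"
    using esc by blast
  have "\<epsilon> / 2 > 0" using \<epsilon>(1) by simp
  from pattern_set_uniform[OF V this, of "p k"]
  obtain \<delta> where \<delta>: "\<delta> > 0" "\<forall>F F'. near_subset \<delta> F F' \<longrightarrow>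
      near_subset (\<epsilon> / 2) (pattern_set G V F (p k)) (pattern_set G V F' (p k))"
    by blast
  have "\<exists>g\<in>B. \<forall>y \<in> pattern_set G (V \<inter> B) F (p k). \<epsilon> / 2 \<le> gdist G g y"
    if F: "F \<subseteq> B" "finite F" "card F = m" for F
  proof -
    have "\<forall>x\<in>F. \<exists>y. y \<in> S \<and> gdist G x y < \<delta>"
      using approx[OF _ \<delta>(1)] F(1) by blast
    then obtain q where q: "\<forall>x\<in>F. q x \<in> S \<and> gdist G x (q x) < \<delta>"
      by (rule bchoice[elim_format]) blast
    obtain P where P: "finite P" "card P = m - card (q ` F)" "P \<subseteq> S - q ` F"
      using infinite_arbitrarily_large[of "S - q ` F" "m - card (q ` F)"] S(2) F(2) by auto
    let ?F' = "q ` F \<union> P"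
    have "card ?F' = m"
      using P F card_image_le[OF F(2), of q] by (subst card_Un_disjoint) auto
    then have "?F' \<in> subsets_of_size (G\<lparr>carrier := S\<rparr>) m"
      using q P F by (auto simp: subsets_of_size_def)
    then obtain g where g: "g \<in> S" "distant G \<epsilon> g (pattern_set G V ?F' (p k))"
      using \<epsilon>(2) by blast
    have "near_subset \<delta> F ?F'"
      unfolding near_subset_def using F B q P S by blast
    then have near: "near_subset (\<epsilon> / 2) (pattern_set G V F (p k)) (pattern_set G V ?F' (p k))"
      using \<delta>(2) by blast
    have "\<epsilon> / 2 \<le> gdist G g y" if y: "y \<in> pattern_set G (V \<inter> B) F (p k)" for y
    proof -
      have y': "y \<in> pattern_set G V F (p k)" using y pattern_set_mono[of "V \<inter> B" V F F] by blast
      then obtain z where z: "z \<in> pattern_set G V ?F' (p k)" "gdist G y z < \<epsilon> / 2"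
        using near by (auto simp: near_subset_def)
      have "\<epsilon> \<le> gdist G g z" using g(2) z(1) by (auto simp: distant_def)
      also have "\<dots> \<le> gdist G g y + gdist G y z"
        using g(1) S(1) y' z(1) near by (intro triangle) (auto simp: near_subset_def)
      finally show ?thesis using z(2) by linarith
    qed
    then show ?thesis using g(1) SB by blast
  qed
  then show "\<exists>\<epsilon>>0. \<forall>F\<in>subsets_of_size (G\<lparr>carrier := B\<rparr>) m. \<exists>g\<in>carrier (G\<lparr>carrier := B\<rparr>).
      distant (G\<lparr>carrier := B\<rparr>) \<epsilon> g (pattern_set (G\<lparr>carrier := B\<rparr>) (V \<inter> B) F (p k))"
    using \<open>\<epsilon> / 2 > 0\<close>
    by (intro exI[of _ "\<epsilon> / 2"])
      (auto simp: distant_def subsets_of_size_def pattern_set_carrier_update)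
qed

lemma (in metric_group) density_character_between:
  assumes "A \<subseteq> B" "B \<subseteq> carrier G" "infinite A"
    and D: "least_dense (gtopology (G\<lparr>carrier := A\<rparr>)) D"
    and S: "dense_in_space (gtopology (G\<lparr>carrier := B\<rparr>)) S" "|S| \<le>o |D|"
  shows "density_character (gtopology (G\<lparr>carrier := A\<rparr>))
    =o density_character (gtopology (G\<lparr>carrier := B\<rparr>))"
proof -
  interpret B: Metric_space B "gdist G" using assms(2) by (rule subspace)
  obtain E where E: "least_dense (gtopology (G\<lparr>carrier := B\<rparr>)) E"
    using least_dense_exists by blast
  then have Ed: "dense_in_space B.mtopology E" by (simp add: least_dense_def)
  have "infinite B" using assms(1,3) finite_subset by blast
  then have "infinite E" using B.infinite_dense Ed by blast
  then obtain D' where D': "dense_in_space (Metric_space.mtopology A (gdist G)) D'" "|D'| \<le>o |E|"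
    using B.dense_subset_of_subspace[OF Ed _ assms(1)] by blast
  have "|D| \<le>o |E|" using D D' by (simp add: least_dense_def) (blast intro: ordLeq_transitive)
  moreover have "|E| \<le>o |D|" using E S ordLeq_transitive unfolding least_dense_def by blast
  ultimately have "|D| =o |E|" by (simp add: ordIso_iff_ordLeq)
  then show ?thesis
    using density_character_ordIso[OF D] density_character_ordIso[OF E]
    by (meson ordIso_symmetric ordIso_transitive)
qed

text \<open>
  A symmetric open set need not contain the identity, so the subgroup has to be made to meet \<open>V\<close>
  before the witness can be restricted. This costs nothing: one more constant operation.
\<close>

lemma bountiful_escapes:
  fixes nbhd :: "'a metric_struct \<Rightarrow> 'a set \<Rightarrow> bool"
  assumes nbhd: "\<And>G V. nbhd G V \<Longrightarrow> openin (gtopology G) V \<and> V \<noteq> {}"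
    and restrict: "\<And>G B V. \<lbrakk>metric_group \<mu> \<iota> G; subgroup B G; nbhd G V; V \<inter> B \<noteq> {}\<rbrakk>
      \<Longrightarrow> nbhd (G\<lparr>carrier := B\<rparr>) (V \<inter> B)"
  shows "bountiful {G. metric_group \<mu> \<iota> G \<and> (\<exists>V. nbhd G V \<and> escapes G V p)}"
  unfolding bountiful_def
proof (intro ballI allI impI)
  fix H :: "'a metric_struct" and A
  assume "H \<in> {G. metric_group \<mu> \<iota> G \<and> (\<exists>V. nbhd G V \<and> escapes G V p)}"
    and A: "subgroup A H \<and> infinite A"
  then obtain V where H: "metric_group \<mu> \<iota> H" and V: "nbhd H V" "escapes H V p" by blast
  interpret H: metric_group \<mu> \<iota> H by (rule H)
  have Vc: "V \<subseteq> carrier H" using nbhd[OF V(1)] by (auto simp: H.openin_mtopology)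
  obtain v where v: "v \<in> V" using nbhd[OF V(1)] by blast
  have Ac: "A \<subseteq> carrier H" using A subgroup.subset by blast
  interpret A: Metric_space A "gdist H" using Ac by (rule H.subspace)
  obtain D where D: "least_dense (gtopology (H\<lparr>carrier := A\<rparr>)) D"
    using least_dense_exists by blast
  then have Dd: "dense_in_space A.mtopology D" by (simp add: least_dense_def)
  have DA: "D \<subseteq> A" using Dd by (simp add: dense_in_space_def)
  have "infinite D" using A.infinite_dense A Dd by blast
  then obtain S where S: "subgroup S H" "D \<subseteq> S" "v \<in> S" "|S| \<le>o |D|"
    and esc: "\<forall>m k. \<exists>\<epsilon>>0. \<forall>F \<in> subsets_of_size (H\<lparr>carrier := S\<rparr>) m. \<exists>g \<in> S.
      distant H \<epsilon> g (pattern_set H V F (p k))"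
    by (rule H.escaping_subgroup[OF V(2) subsetD[OF Vc v] _ subset_trans[OF DA Ac]])
  have Sc: "S \<subseteq> carrier H" using S(1) by (rule subgroup.subset)
  have Sinf: "infinite S" using S(2) \<open>infinite D\<close> finite_subset by blast
  define B where "B = H.mtopology closure_of S"
  have B: "subgroup B H" unfolding B_def using S(1) by (rule H.subgroup_closure)
  have Bc: "B \<subseteq> carrier H" using B by (rule subgroup.subset)
  have SB: "S \<subseteq> B" using Sc by (simp add: B_def closure_of_subset)
  interpret B: Metric_space B "gdist H" using Bc by (rule H.subspace)
  have AB: "A \<subseteq> B"
    unfolding B_def H.metric_closure_of
    using Dd Ac Sc S(2) unfolding A.dense_in_space_iff by (auto simp: subset_iff) metis
  have "dense_in_space B.mtopology S"
    unfolding B.dense_in_space_iff using SB by (auto simp: B_def H.metric_closure_of)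
  then have "density_character (gtopology (H\<lparr>carrier := A\<rparr>))
      =o density_character (gtopology (H\<lparr>carrier := B\<rparr>))"
    using H.density_character_between[OF AB Bc _ D _ S(4)] A by simp
  moreover have "metric_group \<mu> \<iota> (H\<lparr>carrier := B\<rparr>)"
    using H.closed_subgroup_metric_group[OF B] by (simp add: B_def)
  moreover have "nbhd (H\<lparr>carrier := B\<rparr>) (V \<inter> B)"
    using restrict[OF H B V(1)] v S(3) SB by blast
  moreover have "escapes (H\<lparr>carrier := B\<rparr>) (V \<inter> B) p"
    unfolding B_def using H.escapes_closure[OF Sc Sinf Vc esc] .
  ultimately show "\<exists>B. A \<subseteq> B \<and> subgroup B H
      \<and> H\<lparr>carrier := B\<rparr> \<in> {G. metric_group \<mu> \<iota> G \<and> (\<exists>V. nbhd G V \<and> escapes G V p)}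
      \<and> density_character (gtopology (H\<lparr>carrier := A\<rparr>))
        =o density_character (gtopology (H\<lparr>carrier := B\<rparr>))"
    using AB B by blast
qed

lemma bountiful_escapes_open_nbhd_one:
  "bountiful {G :: 'a metric_struct. metric_group \<mu> \<iota> G \<and> (\<exists>V. open_nbhd_one G V \<and> escapes G V p)}"
proof (rule bountiful_escapes)
  show "openin (gtopology G) V \<and> V \<noteq> {}" if "open_nbhd_one G V" for G :: "'a metric_struct" and V
    using that unfolding open_nbhd_one_def by blast
qed (rule metric_group.open_nbhd_one_subgroup)

lemma bountiful_escapes_open_symmetric:
  "bountiful {G :: 'a metric_struct. metric_group \<mu> \<iota> G \<and> (\<exists>V. open_symmetric G V \<and> escapes G V p)}"
proof (rule bountiful_escapes)
  show "openin (gtopology G) V \<and> V \<noteq> {}" if "open_symmetric G V" for G :: "'a metric_struct" and V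
    using that unfolding open_symmetric_def by blast
qed (rule metric_group.open_symmetric_subgroup)

section \<open>The five classes\<close>

lemma uniformly_non_bounded_iff_escapes:
  "uniformly_non_bounded G \<longleftrightarrow>
    (\<exists>V. open_nbhd_one G V \<and> escapes G V (\<lambda>k. Prod Sample (pattern_power Nbhd k)))"
  by (simp add: uniformly_non_bounded_def escapes_def pattern_set_power)

lemma uniformly_non_Roelcke_bounded_iff_escapes:
  "uniformly_non_Roelcke_bounded G \<longleftrightarrow>
    (\<exists>V. open_nbhd_one G V \<and>
      escapes G V (\<lambda>k. Prod (Prod (pattern_power Nbhd k) Sample) (pattern_power Nbhd k)))"
  by (simp add: uniformly_non_Roelcke_bounded_def escapes_def pattern_set_power)

lemma uniformly_non_Roelcke_precompact_iff_escapes: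
  "uniformly_non_Roelcke_precompact G \<longleftrightarrow>
    (\<exists>V. open_nbhd_one G V \<and> escapes G V (\<lambda>_. Prod (Prod Nbhd Sample) Nbhd))"
  by (simp add: uniformly_non_Roelcke_precompact_def escapes_def)

lemma uniformly_non_OB_k_iff_escapes:
  "uniformly_non_OB_k k G \<longleftrightarrow>
    (\<exists>V. open_symmetric G V \<and> escapes G V (\<lambda>_. pattern_power (Prod Sample Nbhd) k))"
  by (simp add: uniformly_non_OB_k_def escapes_def pattern_set_power)

lemma uniformly_non_OB_iff_escapes:
  "uniformly_non_OB G \<longleftrightarrow>
    (\<exists>V. open_symmetric G V \<and> escapes G V (pattern_power (Prod Sample Nbhd)))"
  by (simp add: uniformly_non_OB_def escapes_def pattern_set_power)

theorem proposition2p4: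
  fixes \<mu> \<iota> :: "real \<Rightarrow> real" and k :: nat
  shows "bountiful {G :: 'a metric_struct. metric_group \<mu> \<iota> G \<and> uniformly_non_bounded G}
    \<and> bountiful {G :: 'a metric_struct. metric_group \<mu> \<iota> G \<and> uniformly_non_Roelcke_bounded G}
    \<and> bountiful {G :: 'a metric_struct. metric_group \<mu> \<iota> G \<and> uniformly_non_Roelcke_precompact G}
    \<and> bountiful {G :: 'a metric_struct. metric_group \<mu> \<iota> G \<and> uniformly_non_OB_k k G}
    \<and> bountiful {G :: 'a metric_struct. metric_group \<mu> \<iota> G \<and> uniformly_non_OB G}"
  unfolding uniformly_non_bounded_iff_escapes uniformly_non_Roelcke_bounded_iff_escapes
    uniformly_non_Roelcke_precompact_iff_escapes uniformly_non_OB_k_iff_escapes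
    uniformly_non_OB_iff_escapes
  by (intro conjI bountiful_escapes_open_nbhd_one bountiful_escapes_open_symmetric)

end
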